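(* Let $G$ be a plane graph whose set of vertices has no accumulation point in $\mathbb{R}^2$ and which has bounded vertex degrees, and suppose $G$ is hyperbolic and weakly non-amenable. If every face of $G$ is contained inside a geodetic cycle, then $G$ has bounded codegree, i.e. $\Delta(G^* )<\infty$.
   Context: A plane graph is a graph with a fixed embedding in $\mathbb{R}^2$ with no two edges crossing. A face is a connected component of $\mathbb{R}^2$ minus the image of the graph; its length $|F|$ is the number of edges in its boundary (the vertices and edges mapped into its closure); it is bounded if its length is finite. $\Delta(G^* ):=\sup\{|F| : F\text{ a bounded face}\}$. A set is inside a cycle $C$ if each of its points lies on $C$ or in the bounded component of $\mathbb{R}^2\setminus C$. For vertices $x,y$ on a cycle $C$, $xCy$ and $yCx$ are the two arcs of $C$ between them; $C$ is a geodetic cycle if for every $x,y\in C$ at least one of $xCy,yCx$ is a geodesic of $G$. For finite $S\subset V(G)$, $\partial S$ is the set of vertices outside $S$ adjacent to a vertex of $S$; $G$ is weakly non-amenable if there is a monotone increasing diverging $f:\mathbb{N}\to\mathbb{N}$ with $|S|\le f(|\partial S|)$ for all non-empty finite $S$. A graph is hyperbolic if there is $\delta\ge0$ such that in each connected component every geodetic triangle (three vertices joined pairwise by geodesics) has each side in the $\delta$-neighbourhood of the union of the other two. *)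

theory Defs
  imports "HOL-Analysis.Analysis" "HOL-Library.Extended_Nat"
begin

text \<open>A (simple) graph is given by a vertex set V and a set E of 2-element vertex sets.
  The plane R^2 is modelled by the type complex.  A plane embedding is given by
  a position map p for vertices and an arc map a for edges.\<close>

definition plane_graph ::
  "'v set \<Rightarrow> 'v set set \<Rightarrow> ('v \<Rightarrow> complex) \<Rightarrow> ('v set \<Rightarrow> real \<Rightarrow> complex) \<Rightarrow> bool" where
  "plane_graph V E p a \<longleftrightarrow>
     (\<forall>e\<in>E. \<exists>u v. e = {u, v} \<and> u \<noteq> v \<and> u \<in> V \<and> v \<in> V) \<and>
     inj_on p V \<and>
     (\<forall>e\<in>E. arc (a e) \<and> {pathstart (a e), pathfinish (a e)} = p ` e) \<and>
     (\<forall>e\<in>E. \<forall>v\<in>V. p v \<in> path_image (a e) \<longrightarrow> v \<in> e) \<and>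
     (\<forall>e\<in>E. \<forall>e'\<in>E. e \<noteq> e' \<longrightarrow> path_image (a e) \<inter> path_image (a e') \<subseteq> p ` (e \<inter> e'))"

definition graph_image ::
  "'v set \<Rightarrow> 'v set set \<Rightarrow> ('v \<Rightarrow> complex) \<Rightarrow> ('v set \<Rightarrow> real \<Rightarrow> complex) \<Rightarrow> complex set" where
  "graph_image V E p a = p ` V \<union> (\<Union>e\<in>E. path_image (a e))"

definition faces ::
  "'v set \<Rightarrow> 'v set set \<Rightarrow> ('v \<Rightarrow> complex) \<Rightarrow> ('v set \<Rightarrow> real \<Rightarrow> complex) \<Rightarrow> complex set set" where
  "faces V E p a = components (- graph_image V E p a)"

definition face_edges ::
  "'v set set \<Rightarrow> ('v set \<Rightarrow> real \<Rightarrow> complex) \<Rightarrow> complex set \<Rightarrow> 'v set set" where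
  "face_edges E a F = {e \<in> E. path_image (a e) \<subseteq> closure F}"

text \<open>Delta(G^*): supremum of the lengths of bounded faces (faces of finite length).\<close>
definition codegree ::
  "'v set \<Rightarrow> 'v set set \<Rightarrow> ('v \<Rightarrow> complex) \<Rightarrow> ('v set \<Rightarrow> real \<Rightarrow> complex) \<Rightarrow> enat" where
  "codegree V E p a =
     (SUP F \<in> {F \<in> faces V E p a. finite (face_edges E a F)}. enat (card (face_edges E a F)))"

definition neighbours :: "'v set set \<Rightarrow> 'v \<Rightarrow> 'v set" where
  "neighbours E v = {u. {v, u} \<in> E}"

definition bounded_degree :: "'v set \<Rightarrow> 'v set set \<Rightarrow> bool" where
  "bounded_degree V E \<longleftrightarrow> (\<exists>d::nat. \<forall>v\<in>V. finite (neighbours E v) \<and> card (neighbours E v) \<le> d)"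

definition gpath :: "'v set \<Rightarrow> 'v set set \<Rightarrow> 'v list \<Rightarrow> bool" where
  "gpath V E xs \<longleftrightarrow> xs \<noteq> [] \<and> distinct xs \<and> set xs \<subseteq> V \<and>
     (\<forall>i. Suc i < length xs \<longrightarrow> {xs ! i, xs ! Suc i} \<in> E)"

definition geodesic :: "'v set \<Rightarrow> 'v set set \<Rightarrow> 'v list \<Rightarrow> bool" where
  "geodesic V E xs \<longleftrightarrow> gpath V E xs \<and>
     (\<forall>ys. gpath V E ys \<and> hd ys = hd xs \<and> last ys = last xs \<longrightarrow> length xs \<le> length ys)"

text \<open>Graph distance (number of edges of a shortest path); only used for connected vertices.\<close>
definition gdist :: "'v set \<Rightarrow> 'v set set \<Rightarrow> 'v \<Rightarrow> 'v \<Rightarrow> nat" where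
  "gdist V E u v = (LEAST n. \<exists>xs. gpath V E xs \<and> hd xs = u \<and> last xs = v \<and> length xs = Suc n)"

definition near_side :: "'v set \<Rightarrow> 'v set set \<Rightarrow> real \<Rightarrow> 'v list \<Rightarrow> 'v list \<Rightarrow> 'v list \<Rightarrow> bool" where
  "near_side V E \<delta> P Q R \<longleftrightarrow>
     (\<forall>w\<in>set P. \<exists>w'\<in>set Q \<union> set R. real (gdist V E w w') \<le> \<delta>)"

text \<open>Hyperbolicity: one delta for all geodetic triangles (which automatically lie in
  a single component).\<close>
definition hyperbolic :: "'v set \<Rightarrow> 'v set set \<Rightarrow> bool" where
  "hyperbolic V E \<longleftrightarrow> (\<exists>\<delta>::real. \<delta> \<ge> 0 \<and>
     (\<forall>P Q R. geodesic V E P \<and> geodesic V E Q \<and> geodesic V E R \<and>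
        last P = hd Q \<and> last Q = hd R \<and> last R = hd P \<longrightarrow>
        near_side V E \<delta> P Q R \<and> near_side V E \<delta> Q R P \<and> near_side V E \<delta> R P Q))"

definition vboundary :: "'v set \<Rightarrow> 'v set set \<Rightarrow> 'v set \<Rightarrow> 'v set" where
  "vboundary V E S = {v \<in> V - S. \<exists>u\<in>S. {u, v} \<in> E}"

definition weakly_nonamenable :: "'v set \<Rightarrow> 'v set set \<Rightarrow> bool" where
  "weakly_nonamenable V E \<longleftrightarrow> (\<exists>f::nat \<Rightarrow> nat. mono f \<and> filterlim f at_top at_top \<and>
     (\<forall>S. S \<subseteq> V \<and> finite S \<and> S \<noteq> {} \<longrightarrow> card S \<le> f (card (vboundary V E S))))"

definition gcycle :: "'v set \<Rightarrow> 'v set set \<Rightarrow> 'v list \<Rightarrow> bool" where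
  "gcycle V E xs \<longleftrightarrow> length xs \<ge> 3 \<and> distinct xs \<and> set xs \<subseteq> V \<and>
     (\<forall>i < length xs. {xs ! i, xs ! (Suc i mod length xs)} \<in> E)"

definition cyc_arc :: "'v list \<Rightarrow> nat \<Rightarrow> nat \<Rightarrow> 'v list" where
  "cyc_arc xs i j = map (\<lambda>k. xs ! ((i + k) mod length xs))
      [0 ..< Suc ((j + length xs - i) mod length xs)]"

definition geodetic_cycle :: "'v set \<Rightarrow> 'v set set \<Rightarrow> 'v list \<Rightarrow> bool" where
  "geodetic_cycle V E xs \<longleftrightarrow> gcycle V E xs \<and>
     (\<forall>i < length xs. \<forall>j < length xs. geodesic V E (cyc_arc xs i j) \<or> geodesic V E (cyc_arc xs j i))"

definition cycle_edges :: "'v list \<Rightarrow> 'v set set" where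
  "cycle_edges xs = {{xs ! i, xs ! (Suc i mod length xs)} | i. i < length xs}"

definition cycle_image :: "('v set \<Rightarrow> real \<Rightarrow> complex) \<Rightarrow> 'v list \<Rightarrow> complex set" where
  "cycle_image a xs = (\<Union>e\<in>cycle_edges xs. path_image (a e))"

definition inside_cycle :: "('v set \<Rightarrow> real \<Rightarrow> complex) \<Rightarrow> 'v list \<Rightarrow> complex set \<Rightarrow> bool" where
  "inside_cycle a xs X \<longleftrightarrow> X \<subseteq> cycle_image a xs \<union> inside (cycle_image a xs)"

end

theory Submission
  imports Defs
begin

text \<open>A geodetic cycle of length \<open>n\<close> is isometrically embedded. Its vertices \<open>0\<close>, \<open>\<lfloor>n/3\<rfloor>\<close>,
  \<open>\<lfloor>2n/3\<rfloor>\<close> cut it into arcs of length at most \<open>n/2\<close>, which are the sides of a geodetic triangle,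
  and the midpoint of a side has distance about \<open>n/6\<close> from the other two sides. Hence in a
  hyperbolic graph geodetic cycles have bounded length. The vertices strictly inside a cycle have
  their vertex boundary on the cycle, so weak non-amenability bounds their number. Every edge on the
  boundary of a face inside the cycle joins two vertices on or inside the cycle, so there are
  boundedly many such edges.\<close>

section \<open>Graph distance\<close>

lemma gpath_rev:
  assumes "gpath V E xs"
  shows "gpath V E (rev xs)"
proof -
  have "{rev xs ! i, rev xs ! Suc i} \<in> E" if i: "Suc i < length xs" for i
  proof -
    define k where "k = length xs - Suc (Suc i)"
    have "rev xs ! i = xs ! Suc k" "rev xs ! Suc i = xs ! k"
      using i by (simp_all add: k_def rev_nth Suc_diff_Suc)
    moreover have "{xs ! k, xs ! Suc k} \<in> E"
      using assms i by (simp add: k_def gpath_def)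
    ultimately show ?thesis
      by (simp add: insert_commute)
  qed
  with assms show ?thesis
    by (simp add: gpath_def)
qed

lemma gpath_take:
  assumes "gpath V E xs" "0 < n"
  shows "gpath V E (take n xs)"
  using assms set_take_subset[of n xs] by (auto simp: gpath_def)

lemma gdist_commute: "gdist V E u v = gdist V E v u"
proof -
  let ?joined = "\<lambda>u v n. \<exists>xs. gpath V E xs \<and> hd xs = u \<and> last xs = v \<and> length xs = Suc n"
  have "?joined v u n" if "?joined u v n" for u v n
    using that gpath_rev by (metis hd_rev last_rev length_rev)
  then have "?joined u v = ?joined v u"
    by (intro ext iffI)
  then show ?thesis
    unfolding gdist_def by (rule arg_cong)
qed

lemma gdist_less_length:
  assumes "gpath V E xs"
  shows "gdist V E (hd xs) (last xs) < length xs"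
proof -
  have length_eq: "length xs = Suc (length xs - 1)"
    using assms by (simp add: gpath_def)
  then have "gdist V E (hd xs) (last xs) \<le> length xs - 1"
    unfolding gdist_def using assms by (intro Least_le) blast
  with length_eq show ?thesis
    by linarith
qed

lemma gdist_attained:
  assumes "gpath V E xs"
  obtains ys where "gpath V E ys" "hd ys = hd xs" "last ys = last xs"
    "length ys = Suc (gdist V E (hd xs) (last xs))"
proof -
  have "length xs = Suc (length xs - 1)"
    using assms by (simp add: gpath_def)
  then have "\<exists>n ys. gpath V E ys \<and> hd ys = hd xs \<and> last ys = last xs \<and> length ys = Suc n"
    using assms by blast
  from LeastI_ex[OF this] show thesis
    using that unfolding gdist_def by blast
qed

lemma geodesic_iff_gdist:
  "geodesic V E xs \<longleftrightarrow> gpath V E xs \<and> length xs = Suc (gdist V E (hd xs) (last xs))"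
proof (intro iffI conjI)
  assume geo: "geodesic V E xs"
  then show path: "gpath V E xs"
    by (simp add: geodesic_def)
  obtain ys where "gpath V E ys" "hd ys = hd xs" "last ys = last xs"
      "length ys = Suc (gdist V E (hd xs) (last xs))"
    using path by (rule gdist_attained)
  with geo have "length xs \<le> Suc (gdist V E (hd xs) (last xs))"
    by (metis geodesic_def)
  with gdist_less_length[OF path] show "length xs = Suc (gdist V E (hd xs) (last xs))"
    by linarith
next
  assume "gpath V E xs \<and> length xs = Suc (gdist V E (hd xs) (last xs))"
  then show "geodesic V E xs"
    unfolding geodesic_def using gdist_less_length by (metis Suc_leI)
qed

section \<open>Arcs of cycles\<close>

definition cyc_steps :: "nat \<Rightarrow> nat \<Rightarrow> nat \<Rightarrow> nat" where
  "cyc_steps n i j = (j + n - i) mod n"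

definition cyc_dist :: "nat \<Rightarrow> nat \<Rightarrow> nat \<Rightarrow> nat" where
  "cyc_dist n i j = min (cyc_steps n i j) (cyc_steps n j i)"

lemma cyc_steps_eq_if:
  assumes "i < n" "j < n"
  shows "cyc_steps n i j = (if i \<le> j then j - i else j + n - i)"
proof (cases "i \<le> j")
  case True
  then have "cyc_steps n i j = (j - i) mod n"
    using mod_add_self2[of "j - i" n] by (simp add: cyc_steps_def)
  with assms True show ?thesis
    by simp
qed (use assms in \<open>simp add: cyc_steps_def\<close>)

lemma cyc_dist_commute: "cyc_dist n i j = cyc_dist n j i"
  by (simp add: cyc_dist_def min.commute)

lemma cyc_dist_le_eq:
  assumes "i \<le> j" "j < n"
  shows "cyc_dist n i j = min (j - i) (n - (j - i))"
  using assms by (auto simp: cyc_dist_def cyc_steps_eq_if)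

lemma cyc_dist_outside_arc_ge:
  assumes "m \<le> i" "i < n" "i \<le> l" "l \<le> n"
  shows "min m (i - m) \<le> cyc_dist n m (l mod n)"
proof (cases "l = n")
  case True
  have "cyc_dist n m (l mod n) = min m (n - m)"
    using True assms by (subst cyc_dist_commute) (simp add: cyc_dist_le_eq)
  with True assms show ?thesis
    by linarith
next
  case False
  then have "cyc_dist n m (l mod n) = min (l - m) (n - (l - m))"
    using assms by (simp add: cyc_dist_le_eq)
  with assms show ?thesis
    by linarith
qed

lemma gcycle_rotate:
  assumes "gcycle V E xs"
  shows "gcycle V E (rotate i xs)"
proof -
  have mod_less: "l mod length xs < length xs" for l
    using assms by (intro mod_less_divisor) (auto simp: gcycle_def)
  have "{rotate i xs ! k, rotate i xs ! (Suc k mod length xs)} \<in> E" if "k < length xs" for k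
  proof -
    have "{xs ! ((i + k) mod length xs), xs ! (Suc ((i + k) mod length xs) mod length xs)} \<in> E"
      using assms mod_less by (simp add: gcycle_def)
    with that mod_less show ?thesis
      by (simp add: nth_rotate mod_simps)
  qed
  with assms show ?thesis
    by (simp add: gcycle_def)
qed

lemma gcycle_imp_gpath:
  assumes "gcycle V E xs"
  shows "gpath V E xs"
proof -
  have "{xs ! i, xs ! Suc i} \<in> E" if "Suc i < length xs" for i
    using assms that by (metis Suc_lessD gcycle_def mod_less)
  with assms show ?thesis
    by (auto simp: gcycle_def gpath_def)
qed

lemma length_cyc_arc: "length (cyc_arc xs i j) = Suc (cyc_steps (length xs) i j)"
  by (simp add: cyc_arc_def cyc_steps_def del: upt_Suc)

lemma cyc_arc_eq_take_rotate:
  assumes "xs \<noteq> []"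
  shows "cyc_arc xs i j = take (Suc (cyc_steps (length xs) i j)) (rotate i xs)"
proof -
  have "cyc_steps (length xs) i j < length xs"
    using assms by (simp add: cyc_steps_def)
  then show ?thesis
    by (intro nth_equalityI) (simp_all add: cyc_arc_def nth_rotate cyc_steps_def del: upt_Suc)
qed

lemma gpath_cyc_arc:
  assumes "gcycle V E xs"
  shows "gpath V E (cyc_arc xs i j)"
proof -
  have "xs \<noteq> []"
    using assms by (auto simp: gcycle_def)
  then show ?thesis
    by (simp add: cyc_arc_eq_take_rotate assms gcycle_rotate gcycle_imp_gpath gpath_take)
qed

lemma set_cyc_arc:
  "set (cyc_arc xs i j) = (\<lambda>k. xs ! (k mod length xs)) ` {i..i + cyc_steps (length xs) i j}"
proof -
  have "{i..i + cyc_steps (length xs) i j} = (+) i ` {0..cyc_steps (length xs) i j}"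
    by (simp add: add.commute)
  then show ?thesis
    by (simp only: image_image)
      (simp add: cyc_arc_def cyc_steps_def atLeastLessThanSuc_atLeastAtMost del: upt_Suc)
qed

lemma hd_cyc_arc:
  assumes "i < length xs"
  shows "hd (cyc_arc xs i j) = xs ! i"
  using assms by (simp add: cyc_arc_def hd_map del: upt_Suc)

lemma last_cyc_arc:
  assumes "i < length xs" "j < length xs"
  shows "last (cyc_arc xs i j) = xs ! j"
proof -
  have "(i + (j + length xs - i) mod length xs) mod length xs = (j + length xs) mod length xs"
    using assms by (simp add: mod_simps)
  with assms show ?thesis
    by (simp add: cyc_arc_def)
qed

section \<open>Geodetic cycles in hyperbolic graphs\<close>

lemma geodetic_cycle_imp_gcycle: "geodetic_cycle V E C \<Longrightarrow> gcycle V E C"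
  by (simp add: geodetic_cycle_def)

lemma geodetic_cycle_gdist:
  assumes geodetic: "geodetic_cycle V E C" and bounds: "i < length C" "j < length C"
  shows "gdist V E (C ! i) (C ! j) = cyc_dist (length C) i j"
proof -
  have gdist_le: "gdist V E (C ! k) (C ! l) \<le> cyc_steps (length C) k l"
    if "k < length C" "l < length C" for k l
    using gdist_less_length[OF gpath_cyc_arc[OF geodetic_cycle_imp_gcycle[OF geodetic], of k l]] that
    by (simp add: hd_cyc_arc last_cyc_arc length_cyc_arc)
  have gdist_eq: "gdist V E (C ! k) (C ! l) = cyc_steps (length C) k l"
    if "geodesic V E (cyc_arc C k l)" "k < length C" "l < length C" for k l
    using that by (simp add: geodesic_iff_gdist hd_cyc_arc last_cyc_arc length_cyc_arc)
  have commute: "gdist V E (C ! j) (C ! i) = gdist V E (C ! i) (C ! j)"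
    by (rule gdist_commute)
  have "geodesic V E (cyc_arc C i j) \<or> geodesic V E (cyc_arc C j i)"
    using geodetic bounds by (simp add: geodetic_cycle_def)
  then show ?thesis
    using gdist_le[OF bounds] gdist_le[OF bounds(2,1)] gdist_eq[OF _ bounds]
      gdist_eq[OF _ bounds(2,1)]
    unfolding commute cyc_dist_def by linarith
qed

lemma geodesic_cyc_arc:
  assumes geodetic: "geodetic_cycle V E C" and bounds: "i < length C" "j < length C"
    and short: "2 * cyc_steps (length C) i j \<le> length C"
  shows "geodesic V E (cyc_arc C i j)"
proof -
  have "cyc_steps (length C) i j = cyc_dist (length C) i j"
    using bounds short by (auto simp: cyc_dist_def cyc_steps_eq_if split: if_splits)
  moreover have "gpath V E (cyc_arc C i j)"
    using geodetic by (intro gpath_cyc_arc geodetic_cycle_imp_gcycle)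
  ultimately show ?thesis
    using bounds by (simp add: geodesic_iff_gdist geodetic_cycle_gdist[OF geodetic] hd_cyc_arc
        last_cyc_arc length_cyc_arc)
qed

definition geodetic_triangle ::
  "'v set \<Rightarrow> 'v set set \<Rightarrow> 'v list \<Rightarrow> 'v list \<Rightarrow> 'v list \<Rightarrow> bool" where
  "geodetic_triangle V E P Q R \<longleftrightarrow> geodesic V E P \<and> geodesic V E Q \<and> geodesic V E R \<and>
     last P = hd Q \<and> last Q = hd R \<and> last R = hd P"

text \<open>Nearness of one side suffices, since the vertices of a triangle may be permuted cyclically.\<close>
definition slim_triangles :: "'v set \<Rightarrow> 'v set set \<Rightarrow> real \<Rightarrow> bool" where
  "slim_triangles V E \<delta> \<longleftrightarrow> (\<forall>P Q R. geodetic_triangle V E P Q R \<longrightarrow> near_side V E \<delta> P Q R)"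

lemma hyperbolic_imp_slim_triangles:
  assumes "hyperbolic V E"
  obtains \<delta> where "slim_triangles V E \<delta>"
  using assms unfolding hyperbolic_def slim_triangles_def geodetic_triangle_def by blast

lemma geodetic_triangle_cyc_arcs:
  assumes geodetic: "geodetic_cycle V E C"
    and bounds: "i < length C" "j < length C" "k < length C"
    and short: "2 * cyc_steps (length C) i j \<le> length C" "2 * cyc_steps (length C) j k \<le> length C"
      "2 * cyc_steps (length C) k i \<le> length C"
  shows "geodetic_triangle V E (cyc_arc C i j) (cyc_arc C j k) (cyc_arc C k i)"
  unfolding geodetic_triangle_def using bounds short
  by (simp add: geodesic_cyc_arc[OF geodetic] hd_cyc_arc last_cyc_arc)

lemma geodetic_cycle_gdist_outside_arc_ge:
  assumes geodetic: "geodetic_cycle V E C" and bounds: "m \<le> i" "i \<le> j" "0 < j" "j < length C"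
    and w: "w \<in> set (cyc_arc C i j) \<union> set (cyc_arc C j 0)"
  shows "min m (i - m) \<le> gdist V E (C ! m) w"
proof -
  define n where "n = length C"
  have "cyc_steps n i j = j - i" "cyc_steps n j 0 = n - j"
    using bounds by (simp_all add: cyc_steps_eq_if flip: n_def)
  then have "set (cyc_arc C i j) = (\<lambda>l. C ! (l mod n)) ` {i..j}"
    "set (cyc_arc C j 0) = (\<lambda>l. C ! (l mod n)) ` {j..n}"
    using bounds by (simp_all add: set_cyc_arc flip: n_def)
  with w have "w \<in> (\<lambda>l. C ! (l mod n)) ` ({i..j} \<union> {j..n})"
    by (simp add: image_Un)
  then obtain l where w_eq: "w = C ! (l mod n)" and "l \<in> {i..j} \<union> {j..n}"
    by (rule imageE)
  then have l_bounds: "i \<le> l" "l \<le> n"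
    using bounds by (auto simp flip: n_def)
  have less: "m < n" "l mod n < n"
    using bounds by (simp_all flip: n_def)
  have "min m (i - m) \<le> cyc_dist n m (l mod n)"
    using bounds l_bounds by (intro cyc_dist_outside_arc_ge) (simp_all flip: n_def)
  also have "\<dots> = gdist V E (C ! m) w"
    unfolding w_eq using less by (simp add: geodetic_cycle_gdist[OF geodetic] n_def)
  finally show ?thesis .
qed

lemma slim_triangles_imp_length_geodetic_cycle_le:
  assumes slim: "slim_triangles V E \<delta>" and geodetic: "geodetic_cycle V E C"
  shows "real (length C) \<le> 6 * \<delta> + 5"
proof -
  define n where "n = length C"
  define i where "i = n div 3"
  define j where "j = 2 * n div 3"
  define m where "m = i div 2"
  have "3 \<le> n"
    using geodetic by (simp add: geodetic_cycle_def gcycle_def n_def)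
  then have bounds: "0 < i" "i \<le> j" "j < n"
    and short: "2 * i \<le> n" "2 * (j - i) \<le> n" "2 * (n - j) \<le> n"
    unfolding i_def j_def by linarith+
  have m_le: "m \<le> i" "m \<le> i - m" and n_le: "n \<le> 6 * m + 5"
    unfolding m_def i_def by linarith+
  have steps: "cyc_steps n 0 i = i" "cyc_steps n i j = j - i" "cyc_steps n j 0 = n - j"
    using bounds by (simp_all add: cyc_steps_eq_if)
  have "geodetic_triangle V E (cyc_arc C 0 i) (cyc_arc C i j) (cyc_arc C j 0)"
    using bounds short steps
    by (intro geodetic_triangle_cyc_arcs[OF geodetic]) (auto simp: n_def)
  then have "near_side V E \<delta> (cyc_arc C 0 i) (cyc_arc C i j) (cyc_arc C j 0)"
    using slim by (simp add: slim_triangles_def)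
  moreover have "C ! m \<in> set (cyc_arc C 0 i)"
    using bounds m_le steps by (auto simp: set_cyc_arc simp flip: n_def intro!: image_eqI[of _ _ m])
  ultimately have "\<exists>w\<in>set (cyc_arc C i j) \<union> set (cyc_arc C j 0). real (gdist V E (C ! m) w) \<le> \<delta>"
    unfolding near_side_def by (rule bspec)
  then obtain w where w: "w \<in> set (cyc_arc C i j) \<union> set (cyc_arc C j 0)"
    and near: "real (gdist V E (C ! m) w) \<le> \<delta>"
    by (rule bexE)
  have "m = min m (i - m)"
    using m_le by simp
  also have "\<dots> \<le> gdist V E (C ! m) w"
    using bounds m_le w
    by (intro geodetic_cycle_gdist_outside_arc_ge[OF geodetic]) (simp_all add: n_def)
  finally have "m \<le> gdist V E (C ! m) w" .
  with near n_le show ?thesis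
    unfolding n_def by linarith
qed

section \<open>Plane graphs\<close>

lemma plane_graph_edge_subset: "\<lbrakk>plane_graph V E p a; e \<in> E\<rbrakk> \<Longrightarrow> e \<subseteq> V"
  by (fastforce simp: plane_graph_def)

lemma plane_graph_card_edge: "\<lbrakk>plane_graph V E p a; e \<in> E\<rbrakk> \<Longrightarrow> card e = 2"
  by (fastforce simp: plane_graph_def card_2_iff)

lemma plane_graph_finite_Union:
  assumes "plane_graph V E p a" "finite D" "D \<subseteq> E"
  shows "finite (\<Union> D)"
proof (rule finite_Union)
  show "finite e" if "e \<in> D" for e
    using assms that plane_graph_card_edge[of V E p a e] by (auto intro!: card_ge_0_finite)
qed (rule assms)

lemma plane_graph_path: "\<lbrakk>plane_graph V E p a; e \<in> E\<rbrakk> \<Longrightarrow> path (a e)"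
  by (simp add: plane_graph_def arc_imp_path)

lemma plane_graph_vertex_in_path_image_iff:
  assumes "plane_graph V E p a" "e \<in> E" "v \<in> V"
  shows "p v \<in> path_image (a e) \<longleftrightarrow> v \<in> e"
proof
  show "v \<in> e" if "p v \<in> path_image (a e)"
    using assms that by (simp add: plane_graph_def)
  have "p ` e = {pathstart (a e), pathfinish (a e)}"
    using assms by (simp add: plane_graph_def)
  also have "\<dots> \<subseteq> path_image (a e)"
    by auto
  finally show "p v \<in> path_image (a e)" if "v \<in> e"
    using that by blast
qed

lemma plane_graph_disjoint_path_images:
  assumes "plane_graph V E p a" "e \<in> E" "e' \<in> E" "e \<inter> e' = {}"
  shows "path_image (a e) \<inter> path_image (a e') = {}"
proof -
  have "e \<noteq> e'"
    using assms plane_graph_card_edge by fastforce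
  with assms(1-3) have "path_image (a e) \<inter> path_image (a e') \<subseteq> p ` (e \<inter> e')"
    by (simp add: plane_graph_def)
  with assms show ?thesis
    by simp
qed

definition edges_image :: "('v set \<Rightarrow> real \<Rightarrow> complex) \<Rightarrow> 'v set set \<Rightarrow> complex set" where
  "edges_image a D = (\<Union>e\<in>D. path_image (a e))"

lemma compact_edges_image:
  assumes "plane_graph V E p a" "finite D" "D \<subseteq> E"
  shows "compact (edges_image a D)"
  unfolding edges_image_def using assms
  by (blast intro: compact_UN compact_path_image plane_graph_path)

lemma plane_graph_vertex_in_edges_image_iff:
  assumes "plane_graph V E p a" "D \<subseteq> E" "v \<in> V"
  shows "p v \<in> edges_image a D \<longleftrightarrow> v \<in> \<Union> D"
  using assms plane_graph_vertex_in_path_image_iff unfolding edges_image_def by fast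

lemma plane_graph_edge_disjoint_edges_image:
  assumes "plane_graph V E p a" "D \<subseteq> E" "e \<in> E" "e \<inter> \<Union> D = {}"
  shows "path_image (a e) \<inter> edges_image a D = {}"
  using assms plane_graph_disjoint_path_images unfolding edges_image_def by blast

lemma connected_subset_inside:
  assumes "connected A" "A \<inter> K = {}" "A \<inter> inside K \<noteq> {}"
  shows "A \<subseteq> inside K"
proof
  fix y assume "y \<in> A"
  obtain x where x: "x \<in> A" "x \<in> inside K"
    using assms(3) by blast
  have "connected_component (- K) x y"
    using assms(1,2) x(1) \<open>y \<in> A\<close> unfolding connected_component_def by blast
  then show "y \<in> inside K"
    using x(2) by (rule inside_same_component)
qed

definition vertices_inside :: "'v set \<Rightarrow> ('v \<Rightarrow> complex) \<Rightarrow> complex set \<Rightarrow> 'v set" where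
  "vertices_inside V p K = V \<inter> p -` inside K"

lemma vboundary_vertices_inside_edges_image_subset:
  assumes plane: "plane_graph V E p a" and subgraph: "D \<subseteq> E"
  shows "vboundary V E (vertices_inside V p (edges_image a D)) \<subseteq> \<Union> D"
proof (rule subsetI, rule ccontr)
  let ?K = "edges_image a D"
  fix v assume "v \<in> vboundary V E (vertices_inside V p ?K)" and v_notin: "v \<notin> \<Union> D"
  then obtain u where v: "v \<in> V" "p v \<notin> inside ?K" and u: "u \<in> V" "p u \<in> inside ?K"
    and e: "{u, v} \<in> E"
    by (auto simp: vboundary_def vertices_inside_def)
  have "p u \<notin> ?K"
    using u inside_no_overlap by blast
  then have "u \<notin> \<Union> D"
    using plane subgraph u by (simp add: plane_graph_vertex_in_edges_image_iff)
  with v_notin have "path_image (a {u, v}) \<inter> ?K = {}"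
    using plane subgraph e by (intro plane_graph_edge_disjoint_edges_image) auto
  moreover have "p u \<in> path_image (a {u, v})" "p v \<in> path_image (a {u, v})"
    using plane e u v by (simp_all add: plane_graph_vertex_in_path_image_iff)
  moreover have "connected (path_image (a {u, v}))"
    using plane e by (intro connected_path_image plane_graph_path)
  ultimately have "p v \<in> inside ?K"
    using u connected_subset_inside[of "path_image (a {u, v})" ?K] by blast
  with v show False
    by blast
qed

lemma finite_vimage_bounded:
  fixes p :: "'v \<Rightarrow> 'a :: heine_borel"
  assumes "inj_on p V" "\<forall>z. \<not> z islimpt p ` V" "bounded B"
  shows "finite (V \<inter> p -` B)"
proof -
  have "finite (closure B \<inter> p ` V)"
    using assms by (intro finite_not_islimpt_in_compact) (auto simp: compact_closure)
  then have "finite (p -` (closure B \<inter> p ` V) \<inter> V)"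
    using assms(1) by (rule finite_vimage_IntI)
  then show ?thesis
    by (rule rev_finite_subset) (use closure_subset in auto)
qed

section \<open>Faces inside a finite subgraph\<close>

definition isoperimetric :: "'v set \<Rightarrow> 'v set set \<Rightarrow> (nat \<Rightarrow> nat) \<Rightarrow> bool" where
  "isoperimetric V E f \<longleftrightarrow> mono f \<and>
     (\<forall>S. S \<subseteq> V \<longrightarrow> finite S \<longrightarrow> S \<noteq> {} \<longrightarrow> card S \<le> f (card (vboundary V E S)))"

lemma weakly_nonamenable_imp_isoperimetric:
  assumes "weakly_nonamenable V E"
  obtains f where "isoperimetric V E f"
  using assms unfolding weakly_nonamenable_def isoperimetric_def by blast

lemma isoperimetric_card_le:
  assumes isoper: "isoperimetric V E f" and S: "S \<subseteq> V" "finite S"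
    and card_boundary: "card (vboundary V E S) \<le> n"
  shows "card S \<le> f n"
proof (cases "S = {}")
  case False
  with isoper S have "card S \<le> f (card (vboundary V E S))"
    by (simp add: isoperimetric_def)
  also have "\<dots> \<le> f n"
    using isoper card_boundary by (auto simp: isoperimetric_def dest: monoD)
  finally show ?thesis .
qed simp

lemma face_edges_subset_inside_edges_image:
  assumes plane: "plane_graph V E p a" and subgraph: "finite D" "D \<subseteq> E"
    and F_subset: "F \<subseteq> edges_image a D \<union> inside (edges_image a D)"
  shows "face_edges E a F \<subseteq> {e. e \<subseteq> vertices_inside V p (edges_image a D) \<union> \<Union> D \<and> card e = 2}"
proof (intro subsetI CollectI conjI)
  let ?K = "edges_image a D"
  have "closed (- outside ?K)"
    using compact_edges_image[OF plane subgraph]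
    by (simp add: open_outside compact_imp_closed closed_Compl)
  with F_subset have closure_F: "closure F \<subseteq> ?K \<union> inside ?K"
    unfolding union_with_inside by (rule closure_minimal)
  fix e assume e_in: "e \<in> face_edges E a F"
  then have e: "e \<in> E"
    by (simp add: face_edges_def)
  with plane show "card e = 2"
    by (rule plane_graph_card_edge)
  fix v assume "v \<in> e"
  then have "v \<in> V"
    using plane_graph_edge_subset[OF plane e] by blast
  have "p v \<in> path_image (a e)"
    using plane e \<open>v \<in> V\<close> \<open>v \<in> e\<close> by (simp add: plane_graph_vertex_in_path_image_iff)
  then have "p v \<in> ?K \<union> inside ?K"
    using e_in closure_F by (auto simp: face_edges_def)
  then show "v \<in> vertices_inside V p ?K \<union> \<Union> D"
    using \<open>v \<in> V\<close> plane_graph_vertex_in_edges_image_iff[OF plane subgraph(2)]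
    unfolding vertices_inside_def by blast
qed

lemma finite_vertices_inside_edges_image:
  assumes plane: "plane_graph V E p a" and discrete: "\<forall>z. \<not> z islimpt p ` V"
    and subgraph: "finite D" "D \<subseteq> E"
  shows "finite (vertices_inside V p (edges_image a D))"
  unfolding vertices_inside_def
proof (rule finite_vimage_bounded)
  show "inj_on p V"
    using plane by (simp add: plane_graph_def)
  show "bounded (inside (edges_image a D))"
    using compact_edges_image[OF plane subgraph] by (simp add: bounded_inside compact_imp_bounded)
qed (rule discrete)

lemma card_vertices_inside_edges_image_le:
  assumes plane: "plane_graph V E p a" and discrete: "\<forall>z. \<not> z islimpt p ` V"
    and isoper: "isoperimetric V E f"
    and subgraph: "finite D" "D \<subseteq> E" and card_D: "card (\<Union> D) \<le> n"
  shows "card (vertices_inside V p (edges_image a D)) \<le> f n"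
proof (rule isoperimetric_card_le[OF isoper])
  show "finite (vertices_inside V p (edges_image a D))"
    using plane discrete subgraph by (rule finite_vertices_inside_edges_image)
  have "vboundary V E (vertices_inside V p (edges_image a D)) \<subseteq> \<Union> D"
    using plane subgraph(2) by (rule vboundary_vertices_inside_edges_image_subset)
  then show "card (vboundary V E (vertices_inside V p (edges_image a D))) \<le> n"
    by (rule order_trans[OF card_mono[OF plane_graph_finite_Union[OF plane subgraph]] card_D])
qed (simp add: vertices_inside_def)

lemma card_face_edges_inside_edges_image_le:
  assumes plane: "plane_graph V E p a" and discrete: "\<forall>z. \<not> z islimpt p ` V"
    and isoper: "isoperimetric V E f"
    and subgraph: "finite D" "D \<subseteq> E" and card_D: "card (\<Union> D) \<le> n"
    and F_subset: "F \<subseteq> edges_image a D \<union> inside (edges_image a D)"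
  shows "card (face_edges E a F) \<le> (f n + n) choose 2"
proof -
  define W where "W = vertices_inside V p (edges_image a D) \<union> \<Union> D"
  have fin_W: "finite W"
    unfolding W_def using finite_vertices_inside_edges_image[OF plane discrete subgraph]
      plane_graph_finite_Union[OF plane subgraph] by (rule finite_UnI)
  have card_W: "card W \<le> f n + n"
    unfolding W_def
    using card_vertices_inside_edges_image_le[OF plane discrete isoper subgraph card_D] card_D
    by (intro order_trans[OF card_Un_le] add_mono)
  have "face_edges E a F \<subseteq> {e. e \<subseteq> W \<and> card e = 2}"
    unfolding W_def using plane subgraph F_subset by (rule face_edges_subset_inside_edges_image)
  then have "card (face_edges E a F) \<le> card {e. e \<subseteq> W \<and> card e = 2}"
    using fin_W by (intro card_mono) auto
  also have "\<dots> = card W choose 2"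
    using fin_W by (rule n_subsets)
  also have "\<dots> \<le> (f n + n) choose 2"
    using card_W by (rule binomial_right_mono)
  finally show ?thesis .
qed

lemma cycle_edges_subset: "gcycle V E C \<Longrightarrow> cycle_edges C \<subseteq> E"
  by (auto simp: gcycle_def cycle_edges_def)

lemma finite_cycle_edges: "finite (cycle_edges C)"
  by (simp add: cycle_edges_def)

lemma Union_cycle_edges: "\<Union> (cycle_edges C) = set C"
proof
  have "C ! (Suc i mod length C) \<in> set C" if "i < length C" for i
    using that by (intro nth_mem mod_less_divisor) linarith
  then show "\<Union> (cycle_edges C) \<subseteq> set C"
    by (auto simp: cycle_edges_def)
  have "{C ! i, C ! (Suc i mod length C)} \<in> cycle_edges C" if "i < length C" for i
    using that unfolding cycle_edges_def by blast
  then show "set C \<subseteq> \<Union> (cycle_edges C)"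
    by (metis UnionI in_set_conv_nth insertI1 subsetI)
qed

lemma card_face_edges_inside_cycle_le:
  assumes "plane_graph V E p a" "\<forall>z. \<not> z islimpt p ` V" "isoperimetric V E f"
    and "gcycle V E C" "length C \<le> n" "inside_cycle a C F"
  shows "card (face_edges E a F) \<le> (f n + n) choose 2"
proof (rule card_face_edges_inside_edges_image_le[where D = "cycle_edges C"])
  show "card (\<Union> (cycle_edges C)) \<le> n"
    using assms(5) card_length[of C] by (simp add: Union_cycle_edges)
  show "F \<subseteq> edges_image a (cycle_edges C) \<union> inside (edges_image a (cycle_edges C))"
    using assms(6) by (simp add: inside_cycle_def cycle_image_def edges_image_def)
qed (use assms cycle_edges_subset[OF assms(4)] finite_cycle_edges in auto)

theorem corollary3p2:
  fixes V :: "'v set" and E :: "'v set set"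
    and p :: "'v \<Rightarrow> complex" and a :: "'v set \<Rightarrow> real \<Rightarrow> complex"
  assumes "plane_graph V E p a"
    and "\<forall>z. \<not> z islimpt (p ` V)"
    and "bounded_degree V E"
    and "hyperbolic V E"
    and "weakly_nonamenable V E"
    and "\<forall>F \<in> faces V E p a. \<exists>C. geodetic_cycle V E C \<and> inside_cycle a C F"
  shows "codegree V E p a < \<infinity>"
proof -
  obtain \<delta> where slim: "slim_triangles V E \<delta>"
    using assms(4) by (rule hyperbolic_imp_slim_triangles)
  obtain f where isoper: "isoperimetric V E f"
    using assms(5) by (rule weakly_nonamenable_imp_isoperimetric)
  define n where "n = nat \<lfloor>6 * \<delta> + 5\<rfloor>"
  have "card (face_edges E a F) \<le> (f n + n) choose 2" if face: "F \<in> faces V E p a" for F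
  proof -
    obtain C where cycle: "geodetic_cycle V E C" "inside_cycle a C F"
      using assms(6) face by blast
    have "length C \<le> n"
      using slim_triangles_imp_length_geodetic_cycle_le[OF slim cycle(1)]
      unfolding n_def by (rule le_nat_floor)
    with assms(1,2) isoper geodetic_cycle_imp_gcycle[OF cycle(1)] show ?thesis
      using cycle(2) by (rule card_face_edges_inside_cycle_le)
  qed
  then have "codegree V E p a \<le> enat ((f n + n) choose 2)"
    unfolding codegree_def by (auto intro!: SUP_least)
  then show ?thesis
    by (rule order_le_less_trans) simp
qed

end
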